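(* Let $p$ be a prime and let $Y_1, Y_2 \in \mathcal{C}(\mathbb{Z}_p)$ be two $p$-adic path set fractals in $\mathbb{Z}_p$. Then their Minkowski sum-set $$Y_1 + Y_2 := \{ y_1 + y_2 : y_1 \in Y_1,\ y_2 \in Y_2\}$$ satisfies $Y_1 + Y_2 \in \mathcal{C}(\mathbb{Z}_p)$.
   Context: Let $\mathcal{A}$ be a finite alphabet and $\mathbb{N}=\{0,1,2,\dots\}$. A pointed labeled graph $(\mathcal{G},v)$ over $\mathcal{A}$ consists of a finite directed graph (loops and multiple edges allowed) whose edges are labeled by elements of $\mathcal{A}$, with a marked vertex $v$. Its path set $X_{\mathcal{G}}(v) \subset \mathcal{A}^{\mathbb{N}}$ is the set of label sequences of all one-sided infinite directed walks in $\mathcal{G}$ starting at $v$. Given a digit assignment map $\bar f_p: \mathcal{A} \to \{0,1,\dots,p-1\}$ (not necessarily injective), let $f_p: \mathcal{A}^{\mathbb{N}} \to \mathbb{Z}_p$, $f_p(a_0a_1a_2\cdots) = \sum_{k\ge 0} \bar f_p(a_k)p^k$. A $p$-adic path set fractal is a set of the form $Y = f_p(X_{\mathcal{G}}(v)) \subset \mathbb{Z}_p$ for some such data $(\bar f_p,\mathcal{G},v)$. $\mathcal{C}(\mathbb{Z}_p)$ denotes the collection of all $p$-adic path set fractals. Addition is $p$-adic addition. *)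

theory Defs
  imports
    "HOL-Analysis.Function_Topology"
    "HOL-Algebra.AbelCoset"
    "HOL-Computational_Algebra.Primes"
    "Graph_Theory.Digraph"
begin

text \<open>
  \<open>\<int>\<^sub>p\<close> is the inverse limit of the rings \<open>\<int>/p\<^sup>n\<int>\<close>: a \<open>p\<close>-adic integer \<open>x\<close> is the
  coherent sequence of its residues \<open>x n \<in> {0..<p\<^sup>n}\<close>.  Its \<open>p\<close>-adic topology is the
  inverse limit topology, every \<open>\<int>/p\<^sup>n\<int>\<close> being discrete.
\<close>

definition padic_carrier :: "nat \<Rightarrow> (nat \<Rightarrow> int) set" where
  "padic_carrier p =
     {x. \<forall>n. x n \<in> {0..<int p ^ n} \<and> x (Suc n) mod int p ^ n = x n}"

definition padic_int :: "nat \<Rightarrow> (nat \<Rightarrow> int) ring" where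
  "padic_int p =
     \<lparr>carrier = padic_carrier p,
      monoid.mult = (\<lambda>x y n. (x n * y n) mod int p ^ n),
      monoid.one = (\<lambda>n. 1 mod int p ^ n),
      ring.zero = (\<lambda>n. 0),
      ring.add = (\<lambda>x y n. (x n + y n) mod int p ^ n)\<rparr>"

definition padic_topology :: "nat \<Rightarrow> (nat \<Rightarrow> int) topology" where
  "padic_topology p =
     subtopology (product_topology (\<lambda>_. discrete_topology UNIV) UNIV) (padic_carrier p)"

definition padic_of_int :: "nat \<Rightarrow> int \<Rightarrow> nat \<Rightarrow> int" where
  "padic_of_int p m = (\<lambda>n. m mod int p ^ n)"

lemma padic_of_int_in_carrier:
  assumes "p > 0"
  shows "padic_of_int p m \<in> padic_carrier p"
  using assms by (auto simp: padic_carrier_def padic_of_int_def mod_mod_cancel le_imp_power_dvd)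

lemma cring_padic_int:
  assumes p: "p > 0"
  shows "cring (padic_int p)"
proof -
  have pos: "int p ^ n > 0" for n
    using p by simp
  have range: "0 \<le> x n" "x n < int p ^ n" "x n mod int p ^ n = x n"
    if "x \<in> padic_carrier p" for x n
    using that by (auto simp: padic_carrier_def)
  have coh: "x (Suc n) mod int p ^ n = x n" if "x \<in> padic_carrier p" for x n
    using that by (auto simp: padic_carrier_def)
  have dvd: "int p ^ n dvd int p ^ Suc n" for n
    by (simp add: le_imp_power_dvd)
  have closed: "(\<lambda>n. g (x n) (y n) mod int p ^ n) \<in> padic_carrier p"
    if "x \<in> padic_carrier p" "y \<in> padic_carrier p"
      and g: "\<And>a b m. g (a mod m) (b mod m) mod m = g a b mod m"
    for x y and g :: "int \<Rightarrow> int \<Rightarrow> int"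
  proof -
    have "g (x (Suc n)) (y (Suc n)) mod int p ^ Suc n mod int p ^ n = g (x n) (y n) mod int p ^ n"
      for n
    proof -
      have "g (x (Suc n)) (y (Suc n)) mod int p ^ Suc n mod int p ^ n
          = g (x (Suc n)) (y (Suc n)) mod int p ^ n"
        using dvd by (rule mod_mod_cancel)
      also have "\<dots> = g (x n) (y n) mod int p ^ n"
        using g[of "x (Suc n)" "int p ^ n" "y (Suc n)"] coh that(1,2) by simp
      finally show ?thesis .
    qed
    then show ?thesis
      using pos by (auto simp: padic_carrier_def)
  qed
  have add: "(\<lambda>n. (x n + y n) mod int p ^ n) \<in> padic_carrier p"
    if "x \<in> padic_carrier p" "y \<in> padic_carrier p" for x y
    using closed[OF that, of "(+)"] by (simp add: mod_add_eq)
  have mult: "(\<lambda>n. (x n * y n) mod int p ^ n) \<in> padic_carrier p"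
    if "x \<in> padic_carrier p" "y \<in> padic_carrier p" for x y
    using closed[OF that, of "(*)"] by (simp add: mod_mult_eq)
  have neg: "(\<lambda>n. (- x n) mod int p ^ n) \<in> padic_carrier p"
    if "x \<in> padic_carrier p" for x
    using closed[OF that that, of "\<lambda>a b. - a"] by (simp add: mod_minus_eq)
  have one: "(\<lambda>n. 1 mod int p ^ n) \<in> padic_carrier p"
    using padic_of_int_in_carrier[OF p, of 1] by (simp add: padic_of_int_def)
  have zero: "(\<lambda>n. 0) \<in> padic_carrier p"
    using pos by (simp add: padic_carrier_def)
  show ?thesis
  proof (rule cringI)
    show "abelian_group (padic_int p)"
    proof (rule abelian_groupI; simp add: padic_int_def add zero)
      fix x y z assume xyz: "x \<in> padic_carrier p" "y \<in> padic_carrier p" "z \<in> padic_carrier p"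
      show "(\<lambda>n. ((x n + y n) mod int p ^ n + z n) mod int p ^ n)
          = (\<lambda>n. (x n + (y n + z n) mod int p ^ n) mod int p ^ n)"
        by (simp add: mod_simps add.assoc)
    next
      fix x y assume "x \<in> padic_carrier p" "y \<in> padic_carrier p"
      show "(\<lambda>n. (x n + y n) mod int p ^ n) = (\<lambda>n. (y n + x n) mod int p ^ n)"
        by (simp add: add.commute)
    next
      fix x assume x: "x \<in> padic_carrier p"
      show "(\<lambda>n. x n mod int p ^ n) = x"
        using range[OF x] by simp
      show "\<exists>y\<in>padic_carrier p. (\<lambda>n. (y n + x n) mod int p ^ n) = (\<lambda>n. 0)"
        by (rule bexI[OF _ neg[OF x]]) (simp add: mod_simps)
    qed
    show "comm_monoid (padic_int p)"
    proof (rule comm_monoidI; simp add: padic_int_def mult one)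
      fix x y z assume "x \<in> padic_carrier p" "y \<in> padic_carrier p" "z \<in> padic_carrier p"
      show "(\<lambda>n. ((x n * y n) mod int p ^ n * z n) mod int p ^ n)
          = (\<lambda>n. (x n * ((y n * z n) mod int p ^ n)) mod int p ^ n)"
        by (simp add: mod_simps mult.assoc)
    next
      fix x assume x: "x \<in> padic_carrier p"
      show "(\<lambda>n. (1 mod int p ^ n * x n) mod int p ^ n) = x"
        using range[OF x] by (simp add: mod_simps)
    next
      fix x y assume "x \<in> padic_carrier p" "y \<in> padic_carrier p"
      show "(\<lambda>n. (x n * y n) mod int p ^ n) = (\<lambda>n. (y n * x n) mod int p ^ n)"
        by (simp add: mult.commute)
    qed
    fix x y z
    show "(x \<oplus>\<^bsub>padic_int p\<^esub> y) \<otimes>\<^bsub>padic_int p\<^esub> z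
        = x \<otimes>\<^bsub>padic_int p\<^esub> z \<oplus>\<^bsub>padic_int p\<^esub> y \<otimes>\<^bsub>padic_int p\<^esub> z"
      by (simp add: padic_int_def mod_simps distrib_right)
  qed
qed

text \<open>The arcs of a \<open>fin_digraph\<close> are abstract, so loops and multiple arcs are allowed.\<close>

definition pointed_labeled_graph ::
    "'c set \<Rightarrow> ('a, 'b) pre_digraph \<Rightarrow> ('b \<Rightarrow> 'c) \<Rightarrow> 'a \<Rightarrow> bool" where
  "pointed_labeled_graph A G lab v \<longleftrightarrow>
     finite A \<and> fin_digraph G \<and> lab \<in> arcs G \<rightarrow> A \<and> v \<in> verts G"

definition infinite_walk :: "('a, 'b) pre_digraph \<Rightarrow> 'a \<Rightarrow> (nat \<Rightarrow> 'b) \<Rightarrow> bool" where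
  "infinite_walk G v e \<longleftrightarrow>
     (\<forall>k. e k \<in> arcs G) \<and> tail G (e 0) = v \<and> (\<forall>k. head G (e k) = tail G (e (Suc k)))"

definition path_set :: "('a, 'b) pre_digraph \<Rightarrow> ('b \<Rightarrow> 'c) \<Rightarrow> 'a \<Rightarrow> (nat \<Rightarrow> 'c) set" where
  "path_set G lab v = {lab \<circ> e | e. infinite_walk G v e}"

definition padic_digit_map :: "nat \<Rightarrow> ('c \<Rightarrow> nat) \<Rightarrow> (nat \<Rightarrow> 'c) \<Rightarrow> nat \<Rightarrow> int" where
  "padic_digit_map p d a =
     (THE s. limitin (padic_topology p)
        (\<lambda>N. padic_of_int p (\<Sum>k<N. int (d (a k)) * int p ^ k)) s sequentially)"

text \<open>
  HOL cannot quantify over types inside a formula; the vertices, the arcs and the letters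
  are taken to be natural numbers.  As all three sets are finite this is no restriction,
  see \<open>padic_path_set_fractalsI\<close> below.
\<close>

definition padic_path_set_fractals :: "nat \<Rightarrow> (nat \<Rightarrow> int) set set" where
  "padic_path_set_fractals p =
     {padic_digit_map p d ` path_set G lab v |
        (A :: nat set) (d :: nat \<Rightarrow> nat) (G :: (nat, nat) pre_digraph) (lab :: nat \<Rightarrow> nat) v.
        pointed_labeled_graph A G lab v \<and> d \<in> A \<rightarrow> {0..<p}}"

text \<open>The defining series converges, so the description above is never vacuous.\<close>

lemma padic_digit_map_limitin:
  assumes p: "p > 0"
  shows "limitin (padic_topology p)
           (\<lambda>N. padic_of_int p (\<Sum>k<N. int (d (a k)) * int p ^ k))
           (padic_digit_map p d a) sequentially"
    and "padic_digit_map p d a = (\<lambda>n. (\<Sum>k<n. int (d (a k)) * int p ^ k) mod int p ^ n)"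
proof -
  let ?S = "\<lambda>N. \<Sum>k<N. int (d (a k)) * int p ^ k"
  define s where "s = (\<lambda>n. ?S n mod int p ^ n)"
  have tail: "?S N mod int p ^ n = s n" if "N \<ge> n" for N n
    using that
  proof (induction N rule: dec_induct)
    case base
    then show ?case by (simp add: s_def)
  next
    case (step N)
    have "int p ^ n dvd int (d (a N)) * int p ^ N"
      using step by (simp add: le_imp_power_dvd)
    then have "?S (Suc N) mod int p ^ n = ?S N mod int p ^ n"
      by (simp add: mod_add_right_eq[symmetric] dvd_imp_mod_0)
    then show ?case using step by simp
  qed
  have s: "s \<in> padic_carrier p"
  proof -
    have "s (Suc n) mod int p ^ n = s n" for n
    proof -
      have "s (Suc n) mod int p ^ n = ?S (Suc n) mod int p ^ n"
        unfolding s_def by (rule mod_mod_cancel) (simp add: le_imp_power_dvd)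
      then show ?thesis using tail[of n "Suc n"] by simp
    qed
    then show ?thesis using p by (auto simp: padic_carrier_def s_def)
  qed
  have discrete: "limitin (discrete_topology UNIV) u l sequentially \<longleftrightarrow> eventually (\<lambda>N. u N = l) sequentially"
    for u :: "nat \<Rightarrow> int" and l
    by (auto simp: limitin_def elim: eventually_mono dest: spec[of _ "{l}"])
  have comp: "limitin (padic_topology p) (\<lambda>N. padic_of_int p (?S N)) t sequentially
      \<longleftrightarrow> t \<in> padic_carrier p \<and> (\<forall>n. eventually (\<lambda>N. ?S N mod int p ^ n = t n) sequentially)" for t
    using padic_of_int_in_carrier[OF p]
    by (auto simp: padic_topology_def limitin_subtopology limitin_componentwise
        discrete padic_of_int_def)
  have lim: "limitin (padic_topology p) (\<lambda>N. padic_of_int p (?S N)) s sequentially"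
    unfolding comp eventually_sequentially using s tail by blast
  have uniq: "t = s" if "limitin (padic_topology p) (\<lambda>N. padic_of_int p (?S N)) t sequentially" for t
  proof
    fix n
    have "eventually (\<lambda>N. ?S N mod int p ^ n = t n \<and> ?S N mod int p ^ n = s n) sequentially"
      using that lim unfolding comp by (auto intro: eventually_conj)
    then show "t n = s n"
      by (auto simp: eventually_sequentially)
  qed
  have eq: "padic_digit_map p d a = s"
    unfolding padic_digit_map_def using lim uniq by (rule the_equality)
  show "limitin (padic_topology p) (\<lambda>N. padic_of_int p (?S N)) (padic_digit_map p d a) sequentially"
    using lim by (simp add: eq)
  show "padic_digit_map p d a = (\<lambda>n. ?S n mod int p ^ n)"
    by (simp add: eq s_def)
qed

lemma padic_path_set_fractalsI:
  fixes A :: "'c set" and G :: "('a, 'b) pre_digraph"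
  assumes G: "pointed_labeled_graph A G lab v" and d: "d \<in> A \<rightarrow> {0..<p}"
  shows "padic_digit_map p d ` path_set G lab v \<in> padic_path_set_fractals p"
proof -
  interpret fin_digraph G
    using G by (simp add: pointed_labeled_graph_def)
  have "finite A" and lab: "\<And>e. e \<in> arcs G \<Longrightarrow> lab e \<in> A" and v: "v \<in> verts G"
    using G by (auto simp: pointed_labeled_graph_def)
  obtain f :: "'c \<Rightarrow> nat" where f: "inj_on f A"
    using finite_imp_inj_to_nat_seg[OF \<open>finite A\<close>] by auto
  obtain g :: "'a \<Rightarrow> nat" where g: "inj_on g (verts G)"
    using finite_imp_inj_to_nat_seg[OF finite_verts] by auto
  obtain h :: "'b \<Rightarrow> nat" where h: "inj_on h (arcs G)"
    using finite_imp_inj_to_nat_seg[OF finite_arcs] by auto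
  define hi where "hi = inv_into (arcs G) h"
  define fi where "fi = inv_into A f"
  have hi: "hi (h e) = e" if "e \<in> arcs G" for e
    using that h by (simp add: hi_def)
  have fi: "fi (f c) = c" if "c \<in> A" for c
    using that f by (simp add: fi_def)
  define G' where "G' = \<lparr>verts = g ` verts G, arcs = h ` arcs G,
      tail = g \<circ> tail G \<circ> hi, head = g \<circ> head G \<circ> hi\<rparr>"
  define lab' where "lab' = f \<circ> lab \<circ> hi"
  have "fin_digraph G'"
    by unfold_locales (auto simp: G'_def hi)
  then have G': "pointed_labeled_graph (f ` A) G' lab' (g v)"
    using \<open>finite A\<close> v lab by (auto simp: pointed_labeled_graph_def G'_def lab'_def hi)
  have walk: "infinite_walk G' (g v) (h \<circ> e)" if "infinite_walk G v e" for e
    using that by (auto simp: infinite_walk_def G'_def hi)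
  have walk': "infinite_walk G v (hi \<circ> e)" if e: "infinite_walk G' (g v) e" for e
  proof -
    have arc: "hi (e k) \<in> arcs G" for k
      using e hi by (auto simp: infinite_walk_def G'_def) (metis image_iff)
    have "g (tail G (hi (e 0))) = g v" "\<And>k. g (head G (hi (e k))) = g (tail G (hi (e (Suc k))))"
      using e by (auto simp: infinite_walk_def G'_def)
    then show ?thesis
      using arc v inj_onD[OF g] by (auto simp: infinite_walk_def)
  qed
  have path: "path_set G' lab' (g v) = (\<lambda>a. f \<circ> a) ` path_set G lab v"
  proof (intro equalityI subsetI)
    fix x assume "x \<in> path_set G' lab' (g v)"
    then obtain e where "infinite_walk G' (g v) e" "x = lab' \<circ> e"
      by (auto simp: path_set_def)
    moreover from this have "x = f \<circ> (lab \<circ> (hi \<circ> e))"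
      by (simp add: lab'_def comp_assoc)
    ultimately show "x \<in> (\<lambda>a. f \<circ> a) ` path_set G lab v"
      using walk' unfolding path_set_def by blast
  next
    fix x assume "x \<in> (\<lambda>a. f \<circ> a) ` path_set G lab v"
    then obtain e where e: "infinite_walk G v e" "x = f \<circ> (lab \<circ> e)"
      by (auto simp: path_set_def)
    then have "x = lab' \<circ> (h \<circ> e)"
      by (auto simp: lab'_def hi infinite_walk_def fun_eq_iff)
    then show "x \<in> path_set G' lab' (g v)"
      using walk[OF e(1)] unfolding path_set_def by blast
  qed
  have in_A: "a k \<in> A" if "a \<in> path_set G lab v" for a k
    using that lab by (auto simp: path_set_def infinite_walk_def)
  have "padic_digit_map p (d \<circ> fi) (f \<circ> a) = padic_digit_map p d a"
    if "a \<in> path_set G lab v" for a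
    unfolding padic_digit_map_def using in_A[OF that] by (simp add: fi)
  then have "padic_digit_map p d ` path_set G lab v
      = padic_digit_map p (d \<circ> fi) ` path_set G' lab' (g v)"
    by (simp add: path image_image)
  moreover have "d \<circ> fi \<in> f ` A \<rightarrow> {0..<p}"
    using d fi by auto
  ultimately show ?thesis
    using G' unfolding padic_path_set_fractals_def by blast
qed

end

theory Submission
  imports Defs
begin

text \<open>
  Schoolbook addition in base \<open>p\<close> can be carried out by a finite automaton: at each position it
  reads one digit of either summand, emits their sum plus the incoming carry modulo \<open>p\<close>, and
  passes on the quotient, which is again \<open>0\<close> or \<open>1\<close>.  So two graphs presenting the summands
  are walked through simultaneously while the carry is remembered: the graph for the sum-set has
  the vertices \<open>V\<^sub>1 \<times> V\<^sub>2 \<times> {0, 1}\<close>, and an arc is a pair of arcs together with the incoming carry.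
  Its walks starting with carry \<open>0\<close> are exactly the pairs of walks in the two graphs, because
  the carries are determined by the digits read (\<open>infinite_walk_addition_graph\<close>), and the digits
  emitted along such a walk are those of the sum: cut off after \<open>n\<close> digits, the two summands
  together exceed the emitted number by exactly the carry term \<open>c\<^sub>n p\<^sup>n\<close>, which vanishes modulo \<open>p\<^sup>n\<close> (\<open>digit_sums_eq_carry_digit_sum\<close>).
\<close>

primrec carry :: "nat \<Rightarrow> (nat \<Rightarrow> nat) \<Rightarrow> (nat \<Rightarrow> nat) \<Rightarrow> nat \<Rightarrow> nat" where
  "carry p a b 0 = 0"
| "carry p a b (Suc k) = (a k + b k + carry p a b k) div p"

lemma add_digits_div_le_1:
  fixes a b c p :: nat
  assumes "a < p" "b < p" "c \<le> 1"
  shows "(a + b + c) div p \<le> 1"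
proof -
  have "a + b + c < 2 * p"
    using assms by linarith
  then have "(a + b + c) div p < 2"
    by (simp add: less_mult_imp_div_less)
  then show ?thesis
    by simp
qed

lemma carry_le_1:
  assumes "\<And>k. a k < p" "\<And>k. b k < p"
  shows "carry p a b k \<le> 1"
proof (induction k)
  case (Suc k)
  then show ?case
    using add_digits_div_le_1[OF assms] by simp
qed simp

text \<open>
  The last term is the part of the sum that is still pending after \<open>n\<close> steps. Each step splits
  digit sum plus carry by division with remainder, so nothing is lost from one \<open>n\<close> to the next.
\<close>

lemma digit_sums_eq_carry_digit_sum:
  "(\<Sum>k<n. int (a k) * int p ^ k) + (\<Sum>k<n. int (b k) * int p ^ k)
    = (\<Sum>k<n. int ((a k + b k + carry p a b k) mod p) * int p ^ k)
      + int (carry p a b n) * int p ^ n"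
proof (induction n)
  case 0
  show ?case by simp
next
  case (Suc n)
  define s where "s = a n + b n + carry p a b n"
  have "int s = int (s mod p) + int (s div p) * int p"
    by (metis mod_div_mult_eq of_nat_add of_nat_mult)
  then have "int (a n) + int (b n) + int (carry p a b n)
      = int (s mod p) + int (s div p) * int p"
    by (simp add: s_def)
  then have "(int (a n) + int (b n) + int (carry p a b n)) * int p ^ n
      = int (s mod p) * int p ^ n + int (s div p) * int p ^ Suc n"
    by (simp add: algebra_simps)
  with Suc show ?case
    by (simp add: s_def algebra_simps)
qed

lemma padic_digit_map_add:
  assumes "p > 0"
  shows "padic_digit_map p d1 a \<oplus>\<^bsub>padic_int p\<^esub> padic_digit_map p d2 b
    = padic_digit_map p id (\<lambda>k. (d1 (a k) + d2 (b k)
        + carry p (\<lambda>k. d1 (a k)) (\<lambda>k. d2 (b k)) k) mod p)"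
proof -
  have "((\<Sum>k<n. int (d1 (a k)) * int p ^ k) mod int p ^ n
        + (\<Sum>k<n. int (d2 (b k)) * int p ^ k) mod int p ^ n) mod int p ^ n
      = (\<Sum>k<n. int ((d1 (a k) + d2 (b k)
          + carry p (\<lambda>k. d1 (a k)) (\<lambda>k. d2 (b k)) k) mod p) * int p ^ k) mod int p ^ n" for n
    unfolding mod_add_eq
    by (subst digit_sums_eq_carry_digit_sum[of "\<lambda>k. d1 (a k)" p n "\<lambda>k. d2 (b k)"]) simp
  then show ?thesis
    unfolding padic_digit_map_limitin(2)[OF assms] by (simp only: padic_int_def ring.simps id_apply)
qed

text \<open>
  The maps \<open>w1\<close> and \<open>w2\<close> give the digit read on each arc, that is, the digit assignment applied
  to its label.  An arc records the carry coming in; the carry going out appears only in its head.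
\<close>

definition addition_graph ::
    "nat \<Rightarrow> ('b \<Rightarrow> nat) \<Rightarrow> ('a, 'b) pre_digraph \<Rightarrow> ('d \<Rightarrow> nat) \<Rightarrow> ('c, 'd) pre_digraph
      \<Rightarrow> ('a \<times> 'c \<times> nat, 'b \<times> 'd \<times> nat) pre_digraph" where
  "addition_graph p w1 G1 w2 G2 =
     \<lparr>verts = verts G1 \<times> verts G2 \<times> {..1},
      arcs = arcs G1 \<times> arcs G2 \<times> {..1},
      tail = (\<lambda>(e1, e2, c). (tail G1 e1, tail G2 e2, c)),
      head = (\<lambda>(e1, e2, c). (head G1 e1, head G2 e2, (w1 e1 + w2 e2 + c) div p))\<rparr>"

lemma fin_digraph_addition_graph:
  assumes "fin_digraph G1" "fin_digraph G2"
    and "\<And>e. e \<in> arcs G1 \<Longrightarrow> w1 e < p" "\<And>e. e \<in> arcs G2 \<Longrightarrow> w2 e < p"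
  shows "fin_digraph (addition_graph p w1 G1 w2 G2)"
proof -
  interpret G1: fin_digraph G1 by fact
  interpret G2: fin_digraph G2 by fact
  show ?thesis
    by unfold_locales
      (auto simp: addition_graph_def assms(3,4) intro!: add_digits_div_le_1[simplified])
qed

text \<open>
  Starting with carry \<open>0\<close>, the third components along a walk are forced to be the carries of
  the addition, and conversely these always provide a walk since they never exceed \<open>1\<close>.
\<close>

lemma infinite_walk_addition_graph:
  assumes w: "\<And>e. e \<in> arcs G1 \<Longrightarrow> w1 e < p" "\<And>e. e \<in> arcs G2 \<Longrightarrow> w2 e < p"
  shows "infinite_walk (addition_graph p w1 G1 w2 G2) (v1, v2, 0) e \<longleftrightarrow>
    (\<exists>e1 e2. infinite_walk G1 v1 e1 \<and> infinite_walk G2 v2 e2 \<and>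
      e = (\<lambda>k. (e1 k, e2 k, carry p (\<lambda>k. w1 (e1 k)) (\<lambda>k. w2 (e2 k)) k)))"
    (is "?walk \<longleftrightarrow> ?pair")
proof
  assume e: ?walk
  define e1 e2 c where "e1 k = fst (e k)" and "e2 k = fst (snd (e k))" and "c k = snd (snd (e k))"
    for k
  have e_eq: "e k = (e1 k, e2 k, c k)" for k
    by (simp add: e1_def e2_def c_def)
  have walks: "infinite_walk G1 v1 e1" "infinite_walk G2 v2 e2"
    and c: "c 0 = 0" "\<And>k. c (Suc k) = (w1 (e1 k) + w2 (e2 k) + c k) div p"
    using e by (auto simp: infinite_walk_def addition_graph_def e_eq)
  have "c k = carry p (\<lambda>k. w1 (e1 k)) (\<lambda>k. w2 (e2 k)) k" for k
    by (induction k) (simp_all add: c)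
  with walks show ?pair
    by (auto simp: e_eq fun_eq_iff intro!: exI[of _ e1] exI[of _ e2])
next
  assume ?pair
  then obtain e1 e2 where walks: "infinite_walk G1 v1 e1" "infinite_walk G2 v2 e2"
    and e: "e = (\<lambda>k. (e1 k, e2 k, carry p (\<lambda>k. w1 (e1 k)) (\<lambda>k. w2 (e2 k)) k))"
    by blast
  have "carry p (\<lambda>k. w1 (e1 k)) (\<lambda>k. w2 (e2 k)) k \<le> 1" for k
    using walks w by (intro carry_le_1) (auto simp: infinite_walk_def)
  with walks show ?walk
    by (auto simp: e infinite_walk_def addition_graph_def)
qed

theorem theorem1p3:
  fixes p :: nat and Y1 Y2 :: "(nat \<Rightarrow> int) set"
  assumes "prime p"
    and "Y1 \<in> padic_path_set_fractals p"
    and "Y2 \<in> padic_path_set_fractals p"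
  shows "{y1 \<oplus>\<^bsub>padic_int p\<^esub> y2 | y1 y2. y1 \<in> Y1 \<and> y2 \<in> Y2} \<in> padic_path_set_fractals p"
proof -
  have p: "p > 0"
    using assms(1) by (rule prime_gt_0_nat)
  obtain A1 v1 and d1 lab1 :: "nat \<Rightarrow> nat" and G1 :: "(nat, nat) pre_digraph"
    where Y1: "Y1 = padic_digit_map p d1 ` path_set G1 lab1 v1"
      and G1: "pointed_labeled_graph A1 G1 lab1 v1" and d1: "d1 \<in> A1 \<rightarrow> {0..<p}"
    using assms(2) unfolding padic_path_set_fractals_def by blast
  obtain A2 v2 and d2 lab2 :: "nat \<Rightarrow> nat" and G2 :: "(nat, nat) pre_digraph"
    where Y2: "Y2 = padic_digit_map p d2 ` path_set G2 lab2 v2"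
      and G2: "pointed_labeled_graph A2 G2 lab2 v2" and d2: "d2 \<in> A2 \<rightarrow> {0..<p}"
    using assms(3) unfolding padic_path_set_fractals_def by blast
  define w1 w2 where "w1 = d1 \<circ> lab1" and "w2 = d2 \<circ> lab2"
  have w: "w1 e < p" if "e \<in> arcs G1" for e
    using that G1 d1 by (fastforce simp: w1_def pointed_labeled_graph_def)
  have w': "w2 e < p" if "e \<in> arcs G2" for e
    using that G2 d2 by (fastforce simp: w2_def pointed_labeled_graph_def)
  define G where "G = addition_graph p w1 G1 w2 G2"
  define lab where "lab = (\<lambda>(e1, e2, c). (w1 e1 + w2 e2 + c) mod p)"
  have "fin_digraph G"
    using G1 G2 w w' unfolding G_def
    by (intro fin_digraph_addition_graph) (auto simp: pointed_labeled_graph_def)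
  then have G: "pointed_labeled_graph {0..<p} G lab (v1, v2, 0)"
    using G1 G2 p by (auto simp: pointed_labeled_graph_def G_def addition_graph_def lab_def)
  have add: "padic_digit_map p d1 (lab1 \<circ> e1) \<oplus>\<^bsub>padic_int p\<^esub> padic_digit_map p d2 (lab2 \<circ> e2)
      = padic_digit_map p id
          (lab \<circ> (\<lambda>k. (e1 k, e2 k, carry p (\<lambda>k. w1 (e1 k)) (\<lambda>k. w2 (e2 k)) k)))" for e1 e2
    by (simp add: padic_digit_map_add[OF p] lab_def w1_def w2_def comp_def)
  have "{y1 \<oplus>\<^bsub>padic_int p\<^esub> y2 | y1 y2. y1 \<in> Y1 \<and> y2 \<in> Y2}
      = {padic_digit_map p d1 (lab1 \<circ> e1) \<oplus>\<^bsub>padic_int p\<^esub> padic_digit_map p d2 (lab2 \<circ> e2) | e1 e2.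
          infinite_walk G1 v1 e1 \<and> infinite_walk G2 v2 e2}"
    unfolding Y1 Y2 path_set_def by blast
  also have "\<dots> = {padic_digit_map p id (lab \<circ> e) | e. infinite_walk G (v1, v2, 0) e}"
    unfolding add G_def infinite_walk_addition_graph[of G1 w1 p G2 w2, OF w w', simplified]
    by blast
  also have "\<dots> = padic_digit_map p id ` path_set G lab (v1, v2, 0)"
    unfolding path_set_def by blast
  also have "\<dots> \<in> padic_path_set_fractals p"
    using G by (rule padic_path_set_fractalsI) simp
  finally show ?thesis .
qed

end
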